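(* Let $\beta(s^{*})$ be a unit speed Smarandache curve (according to Bishop frame) of a unit speed regular curve $\alpha(s)$ in $E^3$, with first curvature $k_1^\beta$ and second curvature $k_2^\beta$. Then the centres of the osculating spheres of $\beta(s^{*})$ according to Bishop frame are $$c(s^{*})=\beta(s^{*})+\frac{(k_2^\beta)'}{(k_1^\beta)^2\left(\frac{k_2^\beta}{k_1^\beta}\right)'}\,N_1^\beta-\frac{(k_1^\beta)'}{(k_1^\beta)^2\left(\frac{k_2^\beta}{k_1^\beta}\right)'}\,N_2^\beta .$$
   Context: $E^3$ is Euclidean 3-space. Bishop frame: for a unit speed curve $\gamma$ in $E^3$ with unit tangent $T=\gamma'$, a Bishop frame is a smoothly varying right-handed orthonormal frame $\{T,N_1,N_2\}$ along $\gamma$ (so $N_2=T\wedge N_1$) satisfying $T'=k_1N_1+k_2N_2$, $N_1'=-k_1T$, $N_2'=-k_2T$. The functions $k_1,k_2$ are called the first and second curvatures (natural curvatures, Bishop curvatures) of $\gamma$. For the curve $\beta$ the frame is denoted $\{T_\beta,N_1^\beta,N_2^\beta\}$ and the curvatures $k_1^\beta,k_2^\beta$. Smarandache curves according to Bishop frame: let $\alpha=\alpha(s)$ be a unit speed regular curve in $E^3$ with Bishop frame $\{T_\alpha,N_1^\alpha,N_2^\alpha\}$. A Smarandache curve of $\alpha$ is any one of the curves $\frac{1}{\sqrt2}(T_\alpha+N_1^\alpha)$, $\frac{1}{\sqrt2}(T_\alpha+N_2^\alpha)$, $\frac{1}{\sqrt2}(N_1^\alpha+N_2^\alpha)$, $\frac{1}{\sqrt3}(T_\alpha+N_1^\alpha+N_2^\alpha)$,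 regarded as a curve $\beta(s^{*})$ with its own arc length parameter $s^{*}$. Primes on quantities of $\beta$ denote $d/ds^{*}$. Contact: a regular curve $\gamma$ in $\mathbb{R}^n$ and an implicitly defined hypersurface $F^{-1}(0)$, with $F:\mathbb{R}^n\to\mathbb{R}$ differentiable, have contact of order $k$ at $\gamma(t_0)$ if $(F\circ\gamma)(t_0)=(F\circ\gamma)'(t_0)=\dots=(F\circ\gamma)^{(k)}(t_0)=0$ but $(F\circ\gamma)^{(k+1)}(t_0)\neq0$. For the sphere with centre $c$ and radius $r$ one uses $F(x)=\langle c-x,c-x\rangle-r^2$. An osculating sphere of a space curve is a sphere having contact of third order with the curve.
   Formalization: Osculating spheres are taken to have contact of order at least three: a Smarandache curve lies on the unit sphere, so with the nonvanishing fourth derivative required by the definition of contact no osculating sphere would exist where the formula is defined. *)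

theory Defs
  imports "HOL-Analysis.Analysis"
begin

text \<open>
  Curves are total functions on the reals of which only the values on an open interval matter.
  On an open set the iterated total vector derivative depends only on those values.
\<close>

definition smooth_curve_on :: "real set \<Rightarrow> (real \<Rightarrow> 'a::real_normed_vector) \<Rightarrow> bool" where
  "smooth_curve_on I f \<longleftrightarrow>
     (\<forall>n. \<forall>t\<in>I. ((\<lambda>g u. vector_derivative g (at u)) ^^ n) f differentiable (at t))"

definition unit_speed_curve :: "real set \<Rightarrow> (real \<Rightarrow> real^3) \<Rightarrow> bool" where
  "unit_speed_curve I \<gamma> \<longleftrightarrow>
     open I \<and> is_interval I \<and> I \<noteq> {} \<and> smooth_curve_on I \<gamma> \<and>
     (\<forall>t\<in>I. norm (vector_derivative \<gamma> (at t)) = 1)"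

definition bishop_frame ::
  "real set \<Rightarrow> (real \<Rightarrow> real^3) \<Rightarrow> (real \<Rightarrow> real^3) \<Rightarrow> (real \<Rightarrow> real^3) \<Rightarrow> (real \<Rightarrow> real^3) \<Rightarrow>
   (real \<Rightarrow> real) \<Rightarrow> (real \<Rightarrow> real) \<Rightarrow> bool" where
  "bishop_frame I \<gamma> T N1 N2 k1 k2 \<longleftrightarrow>
     smooth_curve_on I T \<and> smooth_curve_on I N1 \<and> smooth_curve_on I N2 \<and>
     (\<forall>t\<in>I.
        (\<gamma> has_vector_derivative T t) (at t) \<and>
        norm (T t) = 1 \<and> norm (N1 t) = 1 \<and> norm (N2 t) = 1 \<and>
        T t \<bullet> N1 t = 0 \<and> T t \<bullet> N2 t = 0 \<and> N1 t \<bullet> N2 t = 0 \<and>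
        N2 t = cross3 (T t) (N1 t) \<and>
        (T has_vector_derivative (k1 t *\<^sub>R N1 t + k2 t *\<^sub>R N2 t)) (at t) \<and>
        (N1 has_vector_derivative (- k1 t *\<^sub>R T t)) (at t) \<and>
        (N2 has_vector_derivative (- k2 t *\<^sub>R T t)) (at t))"

text \<open>
  The curve \<open>\<beta>\<close>, on the interval \<open>J\<close>, is the regular curve \<open>\<delta>\<close>, on the interval \<open>I\<close>,
  expressed in terms of an arc length function \<open>\<sigma>\<close> of \<open>\<delta>\<close>: an antiderivative of the speed of
  \<open>\<delta>\<close>, hence unique up to the choice of the initial point.
\<close>

definition arclength_reparametrization ::
  "real set \<Rightarrow> (real \<Rightarrow> real^3) \<Rightarrow> real set \<Rightarrow> (real \<Rightarrow> real^3) \<Rightarrow> bool" where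
  "arclength_reparametrization J \<beta> I \<delta> \<longleftrightarrow>
     smooth_curve_on I \<delta> \<and> (\<forall>t\<in>I. vector_derivative \<delta> (at t) \<noteq> 0) \<and>
     (\<exists>\<sigma>. (\<forall>t\<in>I. (\<sigma> has_real_derivative norm (vector_derivative \<delta> (at t))) (at t)) \<and>
          \<sigma> ` I = J \<and> (\<forall>t\<in>I. \<beta> (\<sigma> t) = \<delta> t))"

definition smarandache_curve ::
  "real set \<Rightarrow> (real \<Rightarrow> real^3) \<Rightarrow>
   real set \<Rightarrow> (real \<Rightarrow> real^3) \<Rightarrow> (real \<Rightarrow> real^3) \<Rightarrow> (real \<Rightarrow> real^3) \<Rightarrow> bool" where
  "smarandache_curve J \<beta> I T N1 N2 \<longleftrightarrow>
     (\<exists>\<delta> \<in> {\<lambda>t. (1 / sqrt 2) *\<^sub>R (T t + N1 t),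
             \<lambda>t. (1 / sqrt 2) *\<^sub>R (T t + N2 t),
             \<lambda>t. (1 / sqrt 2) *\<^sub>R (N1 t + N2 t),
             \<lambda>t. (1 / sqrt 3) *\<^sub>R (T t + N1 t + N2 t)}.
        arclength_reparametrization J \<beta> I \<delta>)"

text \<open>
  Contact of the curve \<open>\<gamma>\<close> at \<open>t\<close> with the zero set of \<open>F\<close>, for smooth \<open>\<gamma>\<close> and \<open>F\<close>:
  of order at least \<open>k\<close>, and of order exactly \<open>k\<close>.
\<close>

definition contact_order_at_least :: "(real \<Rightarrow> 'a) \<Rightarrow> real \<Rightarrow> ('a \<Rightarrow> real) \<Rightarrow> nat \<Rightarrow> bool" where
  "contact_order_at_least \<gamma> t F k \<longleftrightarrow> (\<forall>i\<le>k. (deriv ^^ i) (F \<circ> \<gamma>) t = 0)"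

definition contact_order :: "(real \<Rightarrow> 'a) \<Rightarrow> real \<Rightarrow> ('a \<Rightarrow> real) \<Rightarrow> nat \<Rightarrow> bool" where
  "contact_order \<gamma> t F k \<longleftrightarrow>
     (\<forall>i\<le>k. (deriv ^^ i) (F \<circ> \<gamma>) t = 0) \<and> (deriv ^^ Suc k) (F \<circ> \<gamma>) t \<noteq> 0"

definition sphere_fun :: "'a::real_inner \<Rightarrow> real \<Rightarrow> 'a \<Rightarrow> real" where
  "sphere_fun c r x = (c - x) \<bullet> (c - x) - r\<^sup>2"

text \<open>
  The order of contact of an osculating sphere may exceed three, as it must for spherical curves:
  a curve on a sphere has contact of infinite order with it. In particular this happens for all
  Smarandache curves, since each of the four combinations of frame vectors has norm one; a
  definition by contact of order exactly three would leave them without osculating spheres.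
\<close>

definition osculating_sphere ::
  "(real \<Rightarrow> real^3) \<Rightarrow> real \<Rightarrow> real^3 \<Rightarrow> real \<Rightarrow> bool" where
  "osculating_sphere \<gamma> t c r \<longleftrightarrow> r > 0 \<and> contact_order_at_least \<gamma> t (sphere_fun c r) 3"

end

theory Submission
  imports Defs
begin

text \<open>
  Only the Bishop frame of \<open>\<beta>\<close> matters. Put \<open>p = c - \<beta>\<close> and \<open>f = p \<bullet> p - r\<^sup>2\<close>. The frame
  equations give \<open>f' = - 2 (p \<bullet> T)\<close>, \<open>f'' = 2 - 2 (k1 (p \<bullet> N1) + k2 (p \<bullet> N2))\<close> and, once
  \<open>p \<bullet> T = 0\<close>, \<open>f''' = - 2 (k1' (p \<bullet> N1) + k2' (p \<bullet> N2))\<close>. So contact of order three is a linear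
  system for the coordinates of \<open>p\<close> with determinant \<open>k1 k2' - k2 k1' = k1\<^sup>2 (k2 / k1)'\<close>, and
  \<open>p \<noteq> 0\<close> makes the radius positive.
\<close>

text \<open>Contact order is phrased with iterated \<open>deriv\<close>. Since
  \<open>deriv f\<close> coincides with the explicit \<open>g\<close> on a whole neighbourhood of
  \<open>t\<close>, it inherits the derivative of \<open>g\<close>; this allows climbing one order
  at a time.\<close>

lemma has_real_derivative_deriv_cong_open:
  fixes f g h :: "real \<Rightarrow> real"
  assumes "open S" "t \<in> S"
    and "\<And>u. u \<in> S \<Longrightarrow> (f has_real_derivative g u) (at u)"
    and "(g has_real_derivative D) (at t)"
  shows "(deriv f has_real_derivative D) (at t)"
proof (rule has_field_derivative_transform_within_open[OF assms(4,1,2)])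
  show "g u = deriv f u" if "u \<in> S" for u
    using assms(3)[OF that] by (simp add: DERIV_imp_deriv)
qed

lemma smooth_curve_on_differentiable:
  assumes "smooth_curve_on I f" "t \<in> I"
  shows "f differentiable (at t)" "(\<lambda>u. vector_derivative f (at u)) differentiable (at t)"
proof -
  have *: "((\<lambda>g u. vector_derivative g (at u)) ^^ n) f differentiable (at t)" for n
    using assms unfolding smooth_curve_on_def by blast
  show "f differentiable (at t)"
    using *[of 0] by simp
  show "(\<lambda>u. vector_derivative f (at u)) differentiable (at t)"
    using *[of 1] by simp
qed

lemma bishop_frame_curvature_eq:
  assumes "bishop_frame I \<gamma> T N1 N2 k1 k2" "t \<in> I"
  shows "k1 t = vector_derivative T (at t) \<bullet> N1 t" "k2 t = vector_derivative T (at t) \<bullet> N2 t"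
proof -
  have "vector_derivative T (at t) = k1 t *\<^sub>R N1 t + k2 t *\<^sub>R N2 t"
    using assms unfolding bishop_frame_def by (blast intro: vector_derivative_at)
  moreover have "N1 t \<bullet> N1 t = 1" "N2 t \<bullet> N2 t = 1" "N1 t \<bullet> N2 t = 0"
    using assms unfolding bishop_frame_def by (auto simp: dot_square_norm)
  ultimately show "k1 t = vector_derivative T (at t) \<bullet> N1 t"
      "k2 t = vector_derivative T (at t) \<bullet> N2 t"
    by (simp_all add: inner_add_left inner_commute[of "N2 t" "N1 t"])
qed

text \<open>\<open>bishop_frame\<close> imposes smoothness on the frame vectors only. The curvatures
  inherit differentiability from them as the inner products of T' with N1 and N2.\<close>

lemma bishop_frame_curvature_has_derivative:
  assumes fr: "bishop_frame I \<gamma> T N1 N2 k1 k2" and "open I" "t \<in> I"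
  shows "(k1 has_real_derivative deriv k1 t) (at t)" "(k2 has_real_derivative deriv k2 t) (at t)"
proof -
  have sm: "smooth_curve_on I T" "smooth_curve_on I N1" "smooth_curve_on I N2"
    using fr unfolding bishop_frame_def by auto
  have *: "(k has_real_derivative deriv k t) (at t)"
    if N: "smooth_curve_on I N"
      and k: "\<And>u. u \<in> I \<Longrightarrow> k u = vector_derivative T (at u) \<bullet> N u" for k N
  proof -
    have "(\<lambda>u. vector_derivative T (at u) \<bullet> N u) differentiable (at t)"
      using smooth_curve_on_differentiable sm(1) N \<open>t \<in> I\<close> by (intro differentiable_inner) auto
    then obtain D where "((\<lambda>u. vector_derivative T (at u) \<bullet> N u) has_real_derivative D) (at t)"
      by (auto simp: real_differentiable_def)
    \<comment> \<open>The formula for \<open>k\<close> holds only on \<open>I\<close>, so openness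
      is what carries the derivative over.\<close>
    then have "(k has_real_derivative D) (at t)"
      using k by (auto intro: has_field_derivative_transform_within_open[OF _ \<open>open I\<close> \<open>t \<in> I\<close>])
    then show ?thesis
      using DERIV_imp_deriv by blast
  qed
  show "(k1 has_real_derivative deriv k1 t) (at t)" "(k2 has_real_derivative deriv k2 t) (at t)"
    using * sm(2,3) bishop_frame_curvature_eq[OF fr] by blast+
qed

text \<open>By Lagrange's identity the double cross product is a combination of \<open>a\<close> and
  \<open>b\<close> with coefficients \<open>q \<bullet> b\<close> and
  \<open>- (q \<bullet> a)\<close>, so it vanishes. Thus \<open>q\<close> is both parallel and
  orthogonal to the nonzero vector \<open>cross3 a b\<close>. This makes a vector determined by its
  coordinates in a Bishop frame.\<close>

lemma eq_0_if_orthogonal_cross3_frame: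
  fixes q :: "real^3"
  assumes "q \<bullet> a = 0" "q \<bullet> b = 0" "q \<bullet> cross3 a b = 0" "cross3 a b \<noteq> 0"
  shows "q = 0"
proof -
  have "cross3 q (cross3 a b) = 0"
    using assms(1,2) by (simp add: Lagrange)
  then show ?thesis
    using assms(3,4) norm_and_cross_eq_0 by blast
qed

lemma contact_order_at_least_3_sphere_iff:
  assumes fr: "bishop_frame J \<beta> T N1 N2 k1 k2" and "open J" "s \<in> J"
  shows "contact_order_at_least \<beta> s (sphere_fun c r) 3 \<longleftrightarrow>
    (c - \<beta> s) \<bullet> (c - \<beta> s) = r\<^sup>2 \<and> (c - \<beta> s) \<bullet> T s = 0 \<and>
    k1 s * ((c - \<beta> s) \<bullet> N1 s) + k2 s * ((c - \<beta> s) \<bullet> N2 s) = 1 \<and>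
    deriv k1 s * ((c - \<beta> s) \<bullet> N1 s) + deriv k2 s * ((c - \<beta> s) \<bullet> N2 s) = 0"
proof -
  define p where "p t = c - \<beta> t" for t
  define f where "f = sphere_fun c r \<circ> \<beta>"
  define f1 where "f1 t = - 2 * (p t \<bullet> T t)" for t
  define f2 where "f2 t = 2 - 2 * (k1 t * (p t \<bullet> N1 t) + k2 t * (p t \<bullet> N2 t))" for t
  \<comment> \<open>The last term arises from N1' = - k1 T and N2' = - k2 T; it drops out at
    \<open>s\<close> once \<open>f1 s = 0\<close>.\<close>
  define f3 where "f3 t = - 2 * (deriv k1 t * (p t \<bullet> N1 t) + deriv k2 t * (p t \<bullet> N2 t)
    - ((k1 t)\<^sup>2 + (k2 t)\<^sup>2) * (p t \<bullet> T t))" for t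
  have orth: "T t \<bullet> T t = 1" "T t \<bullet> N1 t = 0" "T t \<bullet> N2 t = 0" if "t \<in> J" for t
    using fr that unfolding bishop_frame_def by (auto simp: dot_square_norm)
  have der: "(p has_vector_derivative - T t) (at t)"
    "(T has_vector_derivative (k1 t *\<^sub>R N1 t + k2 t *\<^sub>R N2 t)) (at t)"
    "(N1 has_vector_derivative (- k1 t *\<^sub>R T t)) (at t)"
    "(N2 has_vector_derivative (- k2 t *\<^sub>R T t)) (at t)" if "t \<in> J" for t
    using fr that unfolding bishop_frame_def p_def
    by (auto intro!: derivative_eq_intros)
  have inner: "((\<lambda>u. x u \<bullet> y u) has_real_derivative x t \<bullet> y' + x' \<bullet> y t) (at t)"
    if "(x has_vector_derivative x') (at t)" "(y has_vector_derivative y') (at t)"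
    for x y :: "real \<Rightarrow> real^3" and x' y' t
    using bounded_bilinear.has_vector_derivative[OF bounded_bilinear_inner that]
    by (simp add: has_real_derivative_iff_has_vector_derivative)
  note kder = bishop_frame_curvature_has_derivative[OF fr \<open>open J\<close>]
  have d1: "(f has_real_derivative f1 t) (at t)" if "t \<in> J" for t
  proof -
    have "f = (\<lambda>u. p u \<bullet> p u - r\<^sup>2)"
      by (auto simp: f_def p_def sphere_fun_def)
    then show ?thesis
      using that by (auto intro!: derivative_eq_intros inner der simp: f1_def inner_commute)
  qed
  have d2: "(f1 has_real_derivative f2 t) (at t)" if "t \<in> J" for t
    unfolding f1_def
    by (rule derivative_eq_intros inner der that refl)+
      (simp add: f2_def orth that inner_add_right)
  have d3: "(f2 has_real_derivative f3 t) (at t)" if "t \<in> J" for t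
    unfolding f2_def
    by (rule derivative_eq_intros inner der kder that refl)+
      (simp add: f3_def orth that algebra_simps power2_eq_square)
  have df1: "(deriv f has_real_derivative f2 t) (at t)" if "t \<in> J" for t
    using has_real_derivative_deriv_cong_open[OF \<open>open J\<close> that d1 d2] that by blast
  have df2: "(deriv (deriv f) has_real_derivative f3 t) (at t)" if "t \<in> J" for t
    using has_real_derivative_deriv_cong_open[OF \<open>open J\<close> that df1 d3] that by blast
  have "contact_order_at_least \<beta> s (sphere_fun c r) 3 \<longleftrightarrow>
      f s = 0 \<and> deriv f s = 0 \<and> deriv (deriv f) s = 0 \<and> deriv (deriv (deriv f)) s = 0"
    unfolding contact_order_at_least_def f_def[symmetric]
    by (auto simp: numeral_3_eq_3 le_Suc_eq)
  also have "\<dots> \<longleftrightarrow> f s = 0 \<and> f1 s = 0 \<and> f2 s = 0 \<and> f3 s = 0"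
    using d1[THEN DERIV_imp_deriv] df1[THEN DERIV_imp_deriv] df2[THEN DERIV_imp_deriv] \<open>s \<in> J\<close>
    by simp
  finally show ?thesis
    by (auto simp: f_def f1_def f2_def f3_def p_def sphere_fun_def)
qed

text \<open>Cramer's rule with determinant \<open>D\<close> fixes the normal coordinates of
  \<open>c - \<beta> s\<close>, its tangential one being 0; the radius is then forced to be its
  length.\<close>

lemma osculating_sphere_iff:
  fixes k1 k2 :: "real \<Rightarrow> real"
  assumes fr: "bishop_frame J \<beta> T N1 N2 k1 k2" and "open J" "s \<in> J"
    and D: "D = k1 s * deriv k2 s - k2 s * deriv k1 s" "D \<noteq> 0"
  shows "osculating_sphere \<beta> s c r \<longleftrightarrow>
    c = \<beta> s + (deriv k2 s / D) *\<^sub>R N1 s - (deriv k1 s / D) *\<^sub>R N2 s \<and> r = norm (c - \<beta> s)"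
proof -
  define p where "p = c - \<beta> s"
  define q where "q = (deriv k2 s / D) *\<^sub>R N1 s - (deriv k1 s / D) *\<^sub>R N2 s"
  have N2: "N2 s = cross3 (T s) (N1 s)" and "N2 s \<noteq> 0"
    and orth: "N1 s \<bullet> N1 s = 1" "N2 s \<bullet> N2 s = 1"
      "N1 s \<bullet> T s = 0" "N2 s \<bullet> T s = 0" "N1 s \<bullet> N2 s = 0" "N2 s \<bullet> N1 s = 0"
    using fr \<open>s \<in> J\<close> unfolding bishop_frame_def by (force simp: dot_square_norm inner_commute)+
  have qs: "q \<bullet> T s = 0" "q \<bullet> N1 s = deriv k2 s / D" "q \<bullet> N2 s = - deriv k1 s / D"
    by (simp_all add: q_def inner_diff_left orth)
  \<comment> \<open>The difference \<open>p - q\<close> is orthogonal to T, N1 and their cross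
    product N2 exactly when the coordinates agree.\<close>
  have coords: "p = q \<longleftrightarrow>
      p \<bullet> T s = 0 \<and> p \<bullet> N1 s = deriv k2 s / D \<and> p \<bullet> N2 s = - deriv k1 s / D"
    using eq_0_if_orthogonal_cross3_frame[of "p - q" "T s" "N1 s"] qs N2 \<open>N2 s \<noteq> 0\<close>
    by (auto simp: inner_diff_left)
  have cramer: "k1 s * x + k2 s * y = 1 \<and> deriv k1 s * x + deriv k2 s * y = 0 \<longleftrightarrow>
      x = deriv k2 s / D \<and> y = - deriv k1 s / D" for x y
  proof
    assume "k1 s * x + k2 s * y = 1 \<and> deriv k1 s * x + deriv k2 s * y = 0"
    \<comment> \<open>Eliminate \<open>y\<close> by taking \<open>deriv k2 s\<close> times the first
      equation minus \<open>k2 s\<close> times the second, and \<open>x\<close> by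
      \<open>k1 s\<close> times the second minus \<open>deriv k1 s\<close> times the first.\<close>
    then have "x * D = deriv k2 s" "y * D = - deriv k1 s"
      unfolding D(1) by algebra+
    then show "x = deriv k2 s / D \<and> y = - deriv k1 s / D"
      using D(2) by (metis nonzero_mult_div_cancel_right)
  next
    assume xy: "x = deriv k2 s / D \<and> y = - deriv k1 s / D"
    have "k1 s * x + k2 s * y = (k1 s * deriv k2 s - k2 s * deriv k1 s) / D"
      by (simp add: xy diff_divide_distrib)
    then show "k1 s * x + k2 s * y = 1 \<and> deriv k1 s * x + deriv k2 s * y = 0"
      using D xy by simp
  qed
  \<comment> \<open>The coordinates of \<open>q\<close> solve the system, whose first equation would
    read 0 = 1 for \<open>q = 0\<close>. Hence \<open>norm q\<close> qualifies as a positive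
    radius.\<close>
  have "q \<noteq> 0"
    using cramer[of "q \<bullet> N1 s" "q \<bullet> N2 s"] qs by auto
  then have "osculating_sphere \<beta> s c r \<longleftrightarrow> p = q \<and> r > 0 \<and> p \<bullet> p = r\<^sup>2"
    unfolding osculating_sphere_def
      contact_order_at_least_3_sphere_iff[OF fr \<open>open J\<close> \<open>s \<in> J\<close>] coords p_def[symmetric]
    using cramer[of "p \<bullet> N1 s" "p \<bullet> N2 s"] by blast
  also have "\<dots> \<longleftrightarrow> p = q \<and> r = norm p"
    using \<open>q \<noteq> 0\<close> by (auto simp: dot_square_norm)
  also have "p = q \<longleftrightarrow>
      c = \<beta> s + (deriv k2 s / D) *\<^sub>R N1 s - (deriv k1 s / D) *\<^sub>R N2 s"
    by (auto simp: p_def q_def algebra_simps)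
  finally show ?thesis
    by (simp add: p_def)
qed

text \<open>The set equality asserts existence and uniqueness of the centre; the second conjunct
  covers spheres with contact of order exactly three. The two nonvanishing hypotheses keep the
  denominators in \<open>C\<close> different from 0.\<close>

theorem theorem2:
  fixes I J :: "real set"
    and \<alpha> T\<alpha> N1\<alpha> N2\<alpha> \<beta> T\<beta> N1\<beta> N2\<beta> :: "real \<Rightarrow> real^3"
    and k1\<alpha> k2\<alpha> k1\<beta> k2\<beta> :: "real \<Rightarrow> real"
    and s :: real
  assumes "unit_speed_curve I \<alpha>"
    and "bishop_frame I \<alpha> T\<alpha> N1\<alpha> N2\<alpha> k1\<alpha> k2\<alpha>"
    and "unit_speed_curve J \<beta>"
    and "smarandache_curve J \<beta> I T\<alpha> N1\<alpha> N2\<alpha>"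
    and "bishop_frame J \<beta> T\<beta> N1\<beta> N2\<beta> k1\<beta> k2\<beta>"
    and "s \<in> J"
    and "k1\<beta> s \<noteq> 0"
    and "deriv (\<lambda>u. k2\<beta> u / k1\<beta> u) s \<noteq> 0"
  defines "C \<equiv> \<beta> s
      + (deriv k2\<beta> s / ((k1\<beta> s)\<^sup>2 * deriv (\<lambda>u. k2\<beta> u / k1\<beta> u) s)) *\<^sub>R N1\<beta> s
      - (deriv k1\<beta> s / ((k1\<beta> s)\<^sup>2 * deriv (\<lambda>u. k2\<beta> u / k1\<beta> u) s)) *\<^sub>R N2\<beta> s"
  shows "{c. \<exists>r. osculating_sphere \<beta> s c r} = {C}
    \<and> (\<forall>c r. r > 0 \<and> contact_order \<beta> s (sphere_fun c r) 3 \<longrightarrow> c = C)"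
proof -
  define D where "D = k1\<beta> s * deriv k2\<beta> s - k2\<beta> s * deriv k1\<beta> s"
  have "open J"
    using assms(3) unfolding unit_speed_curve_def by blast
  note kder = bishop_frame_curvature_has_derivative[OF assms(5) \<open>open J\<close> assms(6)]
  \<comment> \<open>The quotient rule identifies the denominator in \<open>C\<close> with the
    determinant \<open>D\<close> of the linear system.\<close>
  have "((\<lambda>u. k2\<beta> u / k1\<beta> u) has_real_derivative D / (k1\<beta> s)\<^sup>2) (at s)"
    by (rule derivative_eq_intros kder assms(7) refl)+
      (simp add: D_def power2_eq_square mult.commute)
  then have D: "(k1\<beta> s)\<^sup>2 * deriv (\<lambda>u. k2\<beta> u / k1\<beta> u) s = D"
    using assms(7) by (simp add: DERIV_imp_deriv)
  then have "D \<noteq> 0"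
    using assms(7,8) by auto
  then have iff: "osculating_sphere \<beta> s c r \<longleftrightarrow> c = C \<and> r = norm (c - \<beta> s)" for c r
    unfolding C_def D
    using osculating_sphere_iff[OF assms(5) \<open>open J\<close> assms(6) D_def] by blast
  \<comment> \<open>Contact of order exactly three is in particular of order at least three, so
    \<open>iff\<close> also locates these centres.\<close>
  moreover have "osculating_sphere \<beta> s c r"
    if "r > 0 \<and> contact_order \<beta> s (sphere_fun c r) 3" for c r
    using that
    by (simp add: osculating_sphere_def contact_order_def contact_order_at_least_def)
  ultimately show ?thesis
    by auto
qed

end
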